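(* Let $m\ge 1$, let $w_1,\dots,w_m$ be scalar weights supported on the same discrete set $\mathcal J$, where either $\mathcal J=\mathbb N_0$ or $\mathcal J=\{0,1,\dots,N\}$, and let $a_1,\dots,a_{m-1}\in\mathbb R\setminus\{0\}$. Define $$A=\sum_{j=1}^{\lfloor m/2\rfloor} a_{2j-1}E_{2j-1,2j}+\sum_{j=1}^{\lfloor (m-1)/2\rfloor} a_{2j}E_{2j+1,2j},\qquad T(x)=e^{Ax}=I+Ax,$$ $$\tilde W(x)=\operatorname{diag}(w_1(x),\dots,w_m(x)),\qquad W(x)=T(x)\tilde W(x)T(x)^*\quad (x\in\mathcal J).$$ Let $P_n(x)=\operatorname{diag}(p_n^{w_1}(x),\dots,p_n^{w_m}(x))$ be the sequence of monic orthogonal polynomials for $\tilde W$, where $p_n^{w_i}$ is the $n$-th monic orthogonal polynomial for $w_i$, extended when $\mathcal J=\{0,\dots,N\}$ by $p_{N+1}^{w_i}(x)=x(x-1)\cdots(x-N)$. Let $\|P_n\|^2=\operatorname{diag}(\|p_n^{w_1}\|^2,\dots,\|p_n^{w_m}\|^2)$. Then $$Q_n(x)=P_n(x)+AP_{n+1}(x)-\|P_n\|^2A^*\|P_{n-1}\|^{-2}P_{n-1}(x)-P_n(x)Ax+\|P_n\|^2A^*\|P_{n-1}\|^{-2}P_{n-1}(x)Ax$$ is a sequence of orthogonal polynomials for $W$, for all $n\in\mathbb N_0$ if $\mathcal J=\mathbb N_0$, and for $n=0,1,\dots,N$ if $\mathcal J=\{0,\dots,N\}$. Here, by convention, $P_{-1}(x)=0$,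 so that $Q_0(x)=P_0(x)+AP_1(x)-P_0(x)Ax$.
   Context: $E_{i,j}$ denotes the $m\times m$ matrix with $1$ in position $(i,j)$ and $0$ elsewhere; $^*$ is the conjugate transpose; $I$ is the identity matrix. Weight matrix: an $m\times m$ weight matrix supported on $\mathcal J$ ($\mathcal J=\mathbb N_0$ or $\{0,1,\dots,N\}$) is a function $W:\mathbb Z\to \operatorname{Mat}_m(\mathbb C)$ such that $W(x)$ is Hermitian positive definite for all $x\in\mathcal J$, $W(x)=0$ for $x\notin\mathcal J$, and all moments $\sum_{x\in\mathcal J}x^nW(x)$, $n\ge 0$, converge. A scalar weight is the case $m=1$ (so it is positive on $\mathcal J$). Inner product: for matrix polynomials $P,Q\in\operatorname{Mat}_m(\mathbb C)[x]$, $\langle P,Q\rangle_W=\sum_{x\in\mathcal J}P(x)W(x)Q(x)^*$. For a scalar weight $w$, $\|p\|^2=\langle p,p\rangle_w$. Sequence of orthogonal polynomials for $W$: a sequence $\{P_n\}$ of $m\times m$ matrix polynomials, indexed by $n\in\mathbb N_0$ (or by $n=0,\dots,N$ if $\mathcal J=\{0,\dots,N\}$), such that $\deg P_n=n$, the leading coefficient of $P_n$ is invertible, and $\langle P_n,P_k\rangle_W=0$ for $n\ne k$. It is monic if every leading coefficient is $I$. For $n=0$ every term containing $P_{-1}$ is taken to be $0$. *)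

theory Defs
  imports "HOL-Analysis.Analysis" "Jordan_Normal_Form.Schur_Decomposition"
begin

section \<open>Matrix weights and matrix polynomials\<close>

text \<open>
  The support is a set of integers, either \<open>\<nat>\<close> or \<open>{0..int N}\<close>. The relation \<open><\<close> on complex
  numbers is the one of Complex_Order: \<open>0 < z\<close> says that \<open>z\<close> is real and positive.
\<close>

definition pos_def_mat :: "nat \<Rightarrow> complex mat \<Rightarrow> bool" where
  "pos_def_mat m M \<longleftrightarrow> M \<in> carrier_mat m m \<and> mat_adjoint M = M \<and>
     (\<forall>v \<in> carrier_vec m. v \<noteq> 0\<^sub>v m \<longrightarrow> 0 < (M *\<^sub>v v) \<bullet>c v)"

text \<open>
  Matrix series are taken entrywise. For \<open>J \<subseteq> \<nat>\<close> the summands of the moments are positive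
  semidefinite, so convergence of the moments is the same as unconditional convergence.
\<close>

definition weight_matrix :: "nat \<Rightarrow> int set \<Rightarrow> (int \<Rightarrow> complex mat) \<Rightarrow> bool" where
  "weight_matrix m J W \<longleftrightarrow>
     (\<forall>x \<in> J. pos_def_mat m (W x)) \<and> (\<forall>x. x \<notin> J \<longrightarrow> W x = 0\<^sub>m m m) \<and>
     (\<forall>n::nat. \<forall>i<m. \<forall>j<m. (\<lambda>x. (of_int x ^ n \<cdot>\<^sub>m W x) $$ (i, j)) summable_on J)"

text \<open>
  An element of \<open>Mat\<^sub>m(\<complex>)[x]\<close> is represented as an \<open>m \<times> m\<close> matrix with entries in \<open>\<complex>[x]\<close>;
  its degree is the largest degree of an entry.
\<close>

definition mpoly_eval :: "complex poly mat \<Rightarrow> int \<Rightarrow> complex mat" where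
  "mpoly_eval P x = map_mat (\<lambda>p. poly p (of_int x)) P"

definition mpoly_degree :: "complex poly mat \<Rightarrow> nat" where
  "mpoly_degree P = Max (degree ` elements_mat P)"

definition mpoly_lead_coeff :: "complex poly mat \<Rightarrow> complex mat" where
  "mpoly_lead_coeff P = map_mat (\<lambda>p. coeff p (mpoly_degree P)) P"

definition mat_const :: "complex mat \<Rightarrow> complex poly mat" where
  "mat_const M = map_mat (\<lambda>c. [:c:]) M"

definition mpoly_inner ::
  "nat \<Rightarrow> int set \<Rightarrow> (int \<Rightarrow> complex mat) \<Rightarrow> complex poly mat \<Rightarrow> complex poly mat \<Rightarrow> complex mat" where
  "mpoly_inner m J W P Q = mat m m (\<lambda>(i, j).
     \<Sum>\<^sub>\<infinity>x\<in>J. (mpoly_eval P x * W x * mat_adjoint (mpoly_eval Q x)) $$ (i, j))"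

text \<open>
  The degrees \<open>n\<close> with \<open>int n \<in> J\<close> are all of them if \<open>J = \<nat>\<close>, and \<open>0, \<dots>, N\<close> if \<open>J = {0..int N}\<close>;
  values of \<open>Q\<close> at other indices are unconstrained. The notion presupposes that \<open>W\<close> is a weight
  matrix, which also makes the series in \<^const>\<open>mpoly_inner\<close> convergent.
\<close>

definition orthogonal_mpolys ::
  "nat \<Rightarrow> int set \<Rightarrow> (int \<Rightarrow> complex mat) \<Rightarrow> (nat \<Rightarrow> complex poly mat) \<Rightarrow> bool" where
  "orthogonal_mpolys m J W Q \<longleftrightarrow> weight_matrix m J W \<and>
     (\<forall>n. int n \<in> J \<longrightarrow> Q n \<in> carrier_mat m m \<and> mpoly_degree (Q n) = n \<and>
        invertible_mat (mpoly_lead_coeff (Q n))) \<and>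
     (\<forall>n k. int n \<in> J \<longrightarrow> int k \<in> J \<longrightarrow> n \<noteq> k \<longrightarrow> mpoly_inner m J W (Q n) (Q k) = 0\<^sub>m m m)"

section \<open>The scalar case\<close>

definition scalar_weight :: "int set \<Rightarrow> (int \<Rightarrow> real) \<Rightarrow> bool" where
  "scalar_weight J w \<longleftrightarrow> (\<forall>x \<in> J. 0 < w x) \<and> (\<forall>x. x \<notin> J \<longrightarrow> w x = 0) \<and>
     (\<forall>n::nat. (\<lambda>x. of_int x ^ n * w x) summable_on J)"

definition scalar_inner ::
  "int set \<Rightarrow> (int \<Rightarrow> real) \<Rightarrow> complex poly \<Rightarrow> complex poly \<Rightarrow> complex" where
  "scalar_inner J w p q =
     (\<Sum>\<^sub>\<infinity>x\<in>J. poly p (of_int x) * of_real (w x) * cnj (poly q (of_int x)))"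

definition monic_orthogonal_polys ::
  "int set \<Rightarrow> (int \<Rightarrow> real) \<Rightarrow> (nat \<Rightarrow> complex poly) \<Rightarrow> bool" where
  "monic_orthogonal_polys J w p \<longleftrightarrow> scalar_weight J w \<and>
     (\<forall>n. int n \<in> J \<longrightarrow> degree (p n) = n \<and> lead_coeff (p n) = 1) \<and>
     (\<forall>n k. int n \<in> J \<longrightarrow> int k \<in> J \<longrightarrow> n \<noteq> k \<longrightarrow> scalar_inner J w (p n) (p k) = 0)"

lemma mat_adjoint_index [simp]:
  "i < dim_col M \<Longrightarrow> j < dim_row M \<Longrightarrow> mat_adjoint M $$ (i, j) = conjugate (M $$ (j, i))"
  by (simp add: mat_adjoint_def mat_of_rows_def)

lemma mat_adjoint_dim [simp]:
  "dim_row (mat_adjoint M) = dim_col M" "dim_col (mat_adjoint M) = dim_row M"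
  by (simp_all add: mat_adjoint_def)

lemma pos_def_mat_1: "pos_def_mat 1 (mat 1 1 (\<lambda>_. complex_of_real c)) \<longleftrightarrow> 0 < c"
proof -
  have adj: "mat_adjoint (mat 1 1 (\<lambda>_. complex_of_real c)) = mat 1 1 (\<lambda>_. complex_of_real c)"
    by (rule eq_matI) auto
  have q: "(mat 1 1 (\<lambda>_. complex_of_real c) *\<^sub>v v) \<bullet>c v = complex_of_real (c * (cmod (v $ 0))\<^sup>2)"
    if "v \<in> carrier_vec 1" for v
    using that
    by (auto simp: scalar_prod_def row_def mult.assoc complex_norm_square simp del: of_real_power)
  have nz: "v \<noteq> 0\<^sub>v 1 \<longleftrightarrow> v $ 0 \<noteq> 0" if "v \<in> carrier_vec 1" for v :: "complex vec"
    using that by (auto simp: vec_eq_iff)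
  have pos: "0 < complex_of_real r \<longleftrightarrow> 0 < r" for r
    by (simp add: less_complex_def)
  show ?thesis
  proof
    assume L: "pos_def_mat 1 (mat 1 1 (\<lambda>_. complex_of_real c))"
    define v :: "complex vec" where "v = vec 1 (\<lambda>_. 1)"
    have v: "v \<in> carrier_vec 1" "v $ 0 = 1" by (auto simp: v_def)
    with L nz[OF v(1)] have "0 < (mat 1 1 (\<lambda>_. complex_of_real c) *\<^sub>v v) \<bullet>c v"
      by (auto simp: pos_def_mat_def)
    then show "0 < c" unfolding q[OF v(1)] pos v(2) by simp
  next
    assume "0 < c"
    then show "pos_def_mat 1 (mat 1 1 (\<lambda>_. complex_of_real c))"
      unfolding pos_def_mat_def using adj nz
      by (auto simp only: q pos mat_carrier) simp
  qed
qed

lemma scalar_weight_iff: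
  "scalar_weight J w \<longleftrightarrow> weight_matrix 1 J (\<lambda>x. mat 1 1 (\<lambda>_. complex_of_real (w x)))"
proof -
  have z: "mat 1 1 (\<lambda>_. complex_of_real c) = 0\<^sub>m 1 1 \<longleftrightarrow> c = 0" for c
    by (auto simp: mat_eq_iff)
  have s: "(\<lambda>x. complex_of_real (f x)) summable_on J \<longleftrightarrow> f summable_on J" for f :: "int \<Rightarrow> real"
    using summable_on_Re[of "\<lambda>x. complex_of_real (f x)" J] summable_on_of_real[of f J]
    by auto
  have e: "(of_int x ^ n \<cdot>\<^sub>m mat 1 1 (\<lambda>_. complex_of_real (w x))) $$ (0, 0)
      = complex_of_real (of_int x ^ n * w x)" for x n
    by simp
  show ?thesis
    unfolding scalar_weight_def weight_matrix_def pos_def_mat_1 z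
    by (simp only: less_one all_simps simp_thms e s)
qed

lemma scalar_inner_eq:
  "mpoly_inner 1 J (\<lambda>x. mat 1 1 (\<lambda>_. complex_of_real (w x))) (mat 1 1 (\<lambda>_. p)) (mat 1 1 (\<lambda>_. q))
     = mat 1 1 (\<lambda>_. scalar_inner J w p q)"
  by (rule eq_matI)
    (auto simp: mpoly_inner_def mpoly_eval_def scalar_inner_def scalar_prod_def intro!: infsum_cong)

lemma monic_orthogonal_polys_iff:
  "monic_orthogonal_polys J w p \<longleftrightarrow>
     orthogonal_mpolys 1 J (\<lambda>x. mat 1 1 (\<lambda>_. complex_of_real (w x))) (\<lambda>n. mat 1 1 (\<lambda>_. p n)) \<and>
     (\<forall>n. int n \<in> J \<longrightarrow> mpoly_lead_coeff (mat 1 1 (\<lambda>_. p n)) = 1\<^sub>m 1)"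
proof -
  have d: "mpoly_degree (mat 1 1 (\<lambda>_. q)) = degree q" for q
    by (simp add: mpoly_degree_def elements_mat_def)
  have l: "mpoly_lead_coeff (mat 1 1 (\<lambda>_. q)) = 1\<^sub>m 1 \<longleftrightarrow> lead_coeff q = 1" for q
    by (auto simp: mpoly_lead_coeff_def d mat_eq_iff simp del: One_nat_def)
  have i: "invertible_mat (1\<^sub>m 1 :: complex mat)"
    by (auto simp: invertible_mat_def inverts_mat_def intro!: exI[of _ "1\<^sub>m 1"])
  have li: "invertible_mat (mpoly_lead_coeff (mat 1 1 (\<lambda>_. q)))" if "lead_coeff q = 1" for q
    using i l[of q] that by metis
  have z: "mat 1 1 (\<lambda>_. c) = 0\<^sub>m 1 1 \<longleftrightarrow> c = 0" for c :: complex
    by (auto simp: mat_eq_iff)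
  show ?thesis
    unfolding monic_orthogonal_polys_def orthogonal_mpolys_def scalar_weight_iff[symmetric]
      scalar_inner_eq z d
    using li by (auto simp: l simp del: One_nat_def)
qed

section \<open>The weight \<open>W\<close> and the polynomials \<open>Q\<^sub>n\<close>\<close>

text \<open>
  Indices of \<open>E\<close>, \<open>w\<close>, \<open>p\<close> and \<open>a\<close> start at 1, while matrix entries are numbered from 0.
\<close>

definition E_unit :: "nat \<Rightarrow> nat \<Rightarrow> nat \<Rightarrow> complex mat" where
  "E_unit m i j = mat m m (\<lambda>(r, s). if Suc r = i \<and> Suc s = j then 1 else 0)"

definition diag_of :: "nat \<Rightarrow> (nat \<Rightarrow> 'a::zero) \<Rightarrow> 'a mat" where
  "diag_of m f = mat_diag m (\<lambda>r. f (Suc r))"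

definition A_mat :: "nat \<Rightarrow> (nat \<Rightarrow> real) \<Rightarrow> complex mat" where
  "A_mat m a = mat m m (\<lambda>rs.
     (\<Sum>j = 1..m div 2. (of_real (a (2*j - 1)) \<cdot>\<^sub>m E_unit m (2*j - 1) (2*j)) $$ rs) +
     (\<Sum>j = 1..(m - 1) div 2. (of_real (a (2*j)) \<cdot>\<^sub>m E_unit m (2*j + 1) (2*j)) $$ rs))"

definition mat_exp :: "nat \<Rightarrow> complex mat \<Rightarrow> complex mat" where
  "mat_exp m B = mat m m (\<lambda>(i, j). \<Sum>k. (B ^\<^sub>m k) $$ (i, j) / fact k)"

definition T_mat :: "nat \<Rightarrow> (nat \<Rightarrow> real) \<Rightarrow> int \<Rightarrow> complex mat" where
  "T_mat m a x = mat_exp m (of_int x \<cdot>\<^sub>m A_mat m a)"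

lemma A_mat_carrier [simp]: "A_mat m a \<in> carrier_mat m m"
  by (simp add: A_mat_def)

lemma A_mat_eq_0:
  assumes "r < m" "s < m" "odd r \<or> even s"
  shows "A_mat m a $$ (r, s) = 0"
proof -
  have "(of_real (a (2*j - 1)) \<cdot>\<^sub>m E_unit m (2*j - 1) (2*j)) $$ (r, s) = 0" if "j \<ge> 1" for j
    using assms that by (auto simp: E_unit_def) presburger+
  moreover have "(of_real (a (2*j)) \<cdot>\<^sub>m E_unit m (2*j + 1) (2*j)) $$ (r, s) = 0" if "j \<ge> 1" for j
    using assms that by (auto simp: E_unit_def) presburger+
  ultimately show ?thesis
    using assms by (simp add: A_mat_def)
qed

lemma A_mat_square: "A_mat m a * A_mat m a = 0\<^sub>m m m"
proof (rule eq_matI)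
  fix r s assume "r < dim_row (0\<^sub>m m m :: complex mat)" "s < dim_col (0\<^sub>m m m :: complex mat)"
  then have rs: "r < m" "s < m" by auto
  have "A_mat m a $$ (r, k) * A_mat m a $$ (k, s) = 0" if "k < m" for k
    using A_mat_eq_0[of r m k a] A_mat_eq_0[of k m s a] rs that by (cases "even k") auto
  then show "(A_mat m a * A_mat m a) $$ (r, s) = 0\<^sub>m m m $$ (r, s)"
    using rs by (auto simp: scalar_prod_def carrier_matD[OF A_mat_carrier] intro!: sum.neutral)
qed (auto simp: carrier_matD[OF A_mat_carrier])

lemma T_mat_eq: "T_mat m a x = 1\<^sub>m m + of_int x \<cdot>\<^sub>m A_mat m a"
proof -
  define B where "B = (of_int x :: complex) \<cdot>\<^sub>m A_mat m a"
  have B: "B \<in> carrier_mat m m" by (simp add: B_def)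
  have B2: "B * B = 0\<^sub>m m m"
    using mult_smult_assoc_mat[OF A_mat_carrier[of m a], of "of_int x \<cdot>\<^sub>m A_mat m a" m "of_int x"]
      mult_smult_distrib[OF A_mat_carrier[of m a] A_mat_carrier[of m a], of "of_int x"]
    by (simp add: B_def A_mat_square)
  have pow: "B ^\<^sub>m (Suc (Suc k)) = 0\<^sub>m m m" for k
  proof (induction k)
    case 0
    show ?case using B B2 by simp
  next
    case (Suc k)
    then show ?case using B by simp
  qed
  have "mat_exp m B = 1\<^sub>m m + B"
  proof (rule eq_matI)
    fix i j assume "i < dim_row (1\<^sub>m m + B)" "j < dim_col (1\<^sub>m m + B)"
    then have ij: "i < m" "j < m" using B by auto
    have "(\<Sum>k. (B ^\<^sub>m k) $$ (i, j) / fact k) = (\<Sum>k\<in>{0, 1}. (B ^\<^sub>m k) $$ (i, j) / fact k)"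
    proof (rule suminf_finite)
      fix k :: nat assume "k \<notin> {0, 1}"
      then obtain l where "k = Suc (Suc l)"
        by (metis insertCI not0_implies_Suc One_nat_def)
      then show "(B ^\<^sub>m k) $$ (i, j) / fact k = 0"
        using pow[of l] ij by simp
    qed auto
    also have "\<dots> = (1\<^sub>m m + B) $$ (i, j)"
      using ij B by simp
    finally show "mat_exp m B $$ (i, j) = (1\<^sub>m m + B) $$ (i, j)"
      using ij by (simp add: mat_exp_def)
  qed (use B in \<open>auto simp: mat_exp_def\<close>)
  then show ?thesis by (simp add: T_mat_def B_def)
qed

definition W_mat :: "nat \<Rightarrow> (nat \<Rightarrow> real) \<Rightarrow> (nat \<Rightarrow> int \<Rightarrow> real) \<Rightarrow> int \<Rightarrow> complex mat" where
  "W_mat m a w x =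
     T_mat m a x * diag_of m (\<lambda>i. of_real (w i x)) * mat_adjoint (T_mat m a x)"

definition P_poly :: "nat \<Rightarrow> (nat \<Rightarrow> nat \<Rightarrow> complex poly) \<Rightarrow> nat \<Rightarrow> complex poly mat" where
  "P_poly m p n = diag_of m (\<lambda>i. p i n)"

definition P_norm2 ::
  "nat \<Rightarrow> int set \<Rightarrow> (nat \<Rightarrow> int \<Rightarrow> real) \<Rightarrow> (nat \<Rightarrow> nat \<Rightarrow> complex poly) \<Rightarrow> nat \<Rightarrow> complex mat" where
  "P_norm2 m J w p n = diag_of m (\<lambda>i. scalar_inner J (w i) (p i n) (p i n))"

definition P_norm2_inv ::
  "nat \<Rightarrow> int set \<Rightarrow> (nat \<Rightarrow> int \<Rightarrow> real) \<Rightarrow> (nat \<Rightarrow> nat \<Rightarrow> complex poly) \<Rightarrow> nat \<Rightarrow> complex mat" where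
  "P_norm2_inv m J w p n = diag_of m (\<lambda>i. inverse (scalar_inner J (w i) (p i n) (p i n)))"

text \<open>The term \<open>\<parallel>P\<^sub>n\<parallel>\<^sup>2 A\<^sup>* \<parallel>P\<^sub>n\<^sub>-\<^sub>1\<parallel>\<^sup>-\<^sup>2 P\<^sub>n\<^sub>-\<^sub>1(x)\<close>, which is 0 for \<open>n = 0\<close>.\<close>

definition S_poly ::
  "nat \<Rightarrow> int set \<Rightarrow> (nat \<Rightarrow> real) \<Rightarrow> (nat \<Rightarrow> int \<Rightarrow> real) \<Rightarrow> (nat \<Rightarrow> nat \<Rightarrow> complex poly) \<Rightarrow>
    nat \<Rightarrow> complex poly mat" where
  "S_poly m J a w p n = (case n of 0 \<Rightarrow> 0\<^sub>m m m
     | Suc k \<Rightarrow> mat_const (P_norm2 m J w p n * mat_adjoint (A_mat m a) * P_norm2_inv m J w p k)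
         * P_poly m p k)"

definition Q_poly ::
  "nat \<Rightarrow> int set \<Rightarrow> (nat \<Rightarrow> real) \<Rightarrow> (nat \<Rightarrow> int \<Rightarrow> real) \<Rightarrow> (nat \<Rightarrow> nat \<Rightarrow> complex poly) \<Rightarrow>
    nat \<Rightarrow> complex poly mat" where
  "Q_poly m J a w p n = (let A = mat_const (A_mat m a); X = [:0, 1:] in
     P_poly m p n + A * P_poly m p (Suc n) - S_poly m J a w p n
     - P_poly m p n * (X \<cdot>\<^sub>m A) + S_poly m J a w p n * (X \<cdot>\<^sub>m A))"

end

theory Submission
  imports Defs
begin

text \<open>
  Since \<open>A\<close> only links even (0-based) rows to odd columns, \<open>A D A = 0\<close> for every diagonal \<open>D\<close>; hence
  \<open>Q\<^sub>n(x) T(x) = P\<^sub>n + A P\<^sub>n\<^sub>+\<^sub>1 - S\<^sub>n\<close> with \<open>S\<^sub>n = \<parallel>P\<^sub>n\<parallel>\<^sup>2 A\<^sup>* \<parallel>P\<^sub>n\<^sub>-\<^sub>1\<parallel>\<^sup>-\<^sup>2 P\<^sub>n\<^sub>-\<^sub>1\<close>, and the inner products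
  of the \<open>Q\<^sub>n\<close> for \<open>W\<close> are those of these polynomials for the diagonal weight. There the terms
  \<open>\<langle>A P\<^sub>n\<^sub>+\<^sub>1, P\<^sub>n\<^sub>+\<^sub>1\<rangle>\<close> and \<open>\<langle>P\<^sub>n, S\<^sub>n\<^sub>+\<^sub>1\<rangle>\<close> are both \<open>A \<parallel>P\<^sub>n\<^sub>+\<^sub>1\<parallel>\<^sup>2\<close> and cancel. The coefficient of \<open>x\<^sup>n\<^sup>+\<^sup>1\<close> in
  \<open>A P\<^sub>n\<^sub>+\<^sub>1 - P\<^sub>n A x\<close> vanishes because all \<open>p\<^sub>n\<close> are monic.
\<close>

section \<open>Series over the support and scalar inner products\<close>

lemma summable_on_finite_sum:
  fixes f :: "'i \<Rightarrow> 'a \<Rightarrow> 'b :: topological_comm_monoid_add"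
  assumes "\<And>i. i \<in> I \<Longrightarrow> f i summable_on A"
  shows "(\<lambda>x. \<Sum>i\<in>I. f i x) summable_on A"
  using assms by (induction I rule: infinite_finite_induct) (auto intro: summable_on_add)

lemma infsum_finite_sum:
  fixes f :: "'i \<Rightarrow> 'a \<Rightarrow> 'b :: {topological_comm_monoid_add, t2_space}"
  assumes "\<And>i. i \<in> I \<Longrightarrow> f i summable_on A"
  shows "(\<Sum>\<^sub>\<infinity>x\<in>A. \<Sum>i\<in>I. f i x) = (\<Sum>i\<in>I. infsum (f i) A)"
  using assms
  by (induction I rule: infinite_finite_induct) (auto simp: infsum_add summable_on_finite_sum)

lemma summable_on_poly_weight:
  fixes f :: "complex poly"
  assumes "scalar_weight J w"
  shows "(\<lambda>x. poly f (of_int x) * of_real (w x)) summable_on J"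
proof -
  \<comment> \<open>The free power \<open>n\<close> absorbs the factor x that \<open>pCons\<close>
    puts in front of the tail in the induction.\<close>
  have "(\<lambda>x. poly f (of_int x) * of_int x ^ n * of_real (w x)) summable_on J" for n
  proof (induction f arbitrary: n)
    case (pCons c f)
    have "(\<lambda>x. of_real (of_int x ^ n * w x) :: complex) summable_on J"
      using assms by (intro summable_on_of_real) (auto simp: scalar_weight_def)
    from summable_on_add[OF summable_on_cmult_right[OF this, of c] pCons.IH[of "Suc n"]]
    show ?case by (simp add: algebra_simps)
  qed simp
  from this[of 0] show ?thesis by simp
qed

lemma summable_on_scalar_inner:
  assumes "scalar_weight J w"
  shows "(\<lambda>x. poly f (of_int x) * of_real (w x) * cnj (poly g (of_int x))) summable_on J"
  \<comment> \<open>Support points are real, so conjugating a value of \<open>g\<close> only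
    conjugates its coefficients.\<close>
  using summable_on_poly_weight[OF assms, of "f * map_poly cnj g"]
  by (simp add: ac_simps)

lemma scalar_inner_cnj: "scalar_inner J w f g = cnj (scalar_inner J w g f)"
  by (simp add: scalar_inner_def flip: infsum_cnj) (simp add: ac_simps)

lemma scalar_inner_smult:
  "scalar_inner J w (Polynomial.smult c f) (Polynomial.smult d g) = c * cnj d * scalar_inner J w f g"
  by (simp add: scalar_inner_def flip: infsum_cmult_right') (simp add: ac_simps)

lemma scalar_inner_eq_0_left:
  assumes "\<And>x. x \<in> J \<Longrightarrow> poly f (of_int x) = 0"
  shows "scalar_inner J w f g = 0"
  using assms by (simp add: scalar_inner_def infsum_0)

text \<open>A zero norm would force \<open>f\<close> to vanish on all of \<open>J\<close>, because
  the weight is positive there; that is more roots than its degree allows.\<close>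

lemma scalar_inner_self_pos:
  assumes w: "scalar_weight J w" and f: "f \<noteq> 0" and J: "infinite J \<or> degree f < card J"
  shows "\<exists>r>0. scalar_inner J w f f = of_real r"
proof -
  define g where "g x = w x * (cmod (poly f (of_int x)))\<^sup>2" for x
  have g: "poly f (of_int x) * of_real (w x) * cnj (poly f (of_int x)) = of_real (g x)" for x
    using complex_norm_square[of "poly f (of_int x)"] by (simp add: g_def ac_simps)
  have sg: "g summable_on J"
    using summable_on_Re[OF summable_on_scalar_inner[OF w, of f f]] by (simp add: g)
  have g0: "g x \<ge> 0" if "x \<in> J" for x
    using w that by (simp add: g_def scalar_weight_def less_imp_le)
  have "infsum g J > 0"
  proof (rule ccontr)
    assume "\<not> infsum g J > 0"
    then have "g x = 0" if "x \<in> J" for x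
      using nonneg_infsum_le_0D[OF _ sg g0 that] by simp
    moreover have "w x > 0" if "x \<in> J" for x using w that by (simp add: scalar_weight_def)
    ultimately have "of_int ` J \<subseteq> {z. poly f z = 0}" by (fastforce simp: g_def)
    moreover have inj: "inj_on (of_int :: int \<Rightarrow> complex) J" by (simp add: inj_on_def)
    ultimately have "finite J" "card J \<le> degree f"
      using poly_roots_finite[OF f] finite_subset[of "of_int ` J" "{z. poly f z = 0}"]
        card_mono[of "{z. poly f z = 0}" "of_int ` J"] poly_roots_degree[OF f]
      by (auto simp: finite_image_iff card_image)
    with J show False by auto
  qed
  moreover have "scalar_inner J w f f = of_real (infsum g J)"
    using infsumI[OF has_sum_of_real[OF has_sum_infsum[OF sg]]] by (simp add: scalar_inner_def g)
  ultimately show ?thesis by blast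
qed

section \<open>Invertibility, adjoints and congruence of matrices\<close>

lemma invertible_mat_if_inj:
  fixes M :: "'a :: field mat"
  assumes M: "M \<in> carrier_mat n n" and inj: "\<And>v. v \<in> carrier_vec n \<Longrightarrow> M *\<^sub>v v = 0\<^sub>v n \<Longrightarrow> v = 0\<^sub>v n"
  shows "invertible_mat M"
proof -
  have "det M \<noteq> 0" using det_0_iff_vec_prod_zero[OF M] inj by blast
  from det_non_zero_imp_unit[OF M this, of "()"] M show ?thesis
    by (auto simp: Units_def ring_mat_def invertible_mat_def inverts_mat_def)
qed

lemma mat_adjoint_mult:
  fixes A B :: "complex mat"
  assumes "A \<in> carrier_mat n k" "B \<in> carrier_mat k m"
  shows "mat_adjoint (A * B) = mat_adjoint B * mat_adjoint A"
  using assms by (intro eq_matI) (auto simp: scalar_prod_def ac_simps)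

lemma mat_diag_congruence_index:
  fixes A B :: "complex mat"
  assumes "A \<in> carrier_mat n m" "B \<in> carrier_mat k m" "i < n" "j < k"
  shows "(A * mat_diag m d * mat_adjoint B) $$ (i, j)
    = (\<Sum>s<m. A $$ (i, s) * d s * cnj (B $$ (j, s)))"
  using assms by (simp add: mat_diag_mult_right[of A n m] scalar_prod_def atLeast0LessThan)

text \<open>With \<open>u\<close> the adjoint of \<open>T\<close> applied to \<open>v\<close>, the
  quadratic form at \<open>v\<close> is the sum of d_s |u_s|^2. The right inverse \<open>S\<close>
  of \<open>T\<close> gives a left inverse of that adjoint, so \<open>u\<close> is nonzero whenever
  \<open>v\<close> is.\<close>

lemma pos_def_mat_congruence:
  assumes T: "T \<in> carrier_mat m m" and S: "S \<in> carrier_mat m m" and TS: "T * S = 1\<^sub>m m"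
    and d: "\<And>s. s < m \<Longrightarrow> d s > 0"
  shows "pos_def_mat m (T * mat_diag m (\<lambda>s. of_real (d s)) * mat_adjoint T)"
proof -
  define M where "M = T * mat_diag m (\<lambda>s. of_real (d s)) * mat_adjoint T"
  have T': "mat_adjoint T \<in> carrier_mat m m" and S': "mat_adjoint S \<in> carrier_mat m m"
    using T S by auto
  have M: "M \<in> carrier_mat m m" unfolding M_def by (intro mult_carrier_mat[of _ m m] T T' mat_diag_dim)
  have Mij: "M $$ (i, j) = (\<Sum>s<m. T $$ (i, s) * of_real (d s) * cnj (T $$ (j, s)))"
    if "i < m" "j < m" for i j
    unfolding M_def using that by (intro mat_diag_congruence_index[OF T T])
  have herm: "mat_adjoint M = M"
  proof (rule eq_matI)
    fix i j assume "i < dim_row M" "j < dim_col M"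
    then have "i < m" "j < m" using M by auto
    then show "mat_adjoint M $$ (i, j) = M $$ (i, j)"
      using M by (simp add: Mij) (simp add: ac_simps)
  qed (use M in auto)
  have pos: "0 < (M *\<^sub>v v) \<bullet>c v" if v: "v \<in> carrier_vec m" and "v \<noteq> 0\<^sub>v m" for v
  proof -
    define u where "u = mat_adjoint T *\<^sub>v v"
    have u: "u \<in> carrier_vec m" using T' v by (simp add: u_def)
    have us: "u $ s = (\<Sum>j<m. cnj (T $$ (j, s)) * v $ j)" if "s < m" for s
      using T v that by (simp add: u_def scalar_prod_def atLeast0LessThan)
    have "mat_adjoint S *\<^sub>v u = mat_adjoint (T * S) *\<^sub>v v"
      unfolding u_def mat_adjoint_mult[OF T S] using v T' S' by simp
    also have "mat_adjoint (T * S) = 1\<^sub>m m" unfolding TS by (intro eq_matI) auto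
    finally have "mat_adjoint S *\<^sub>v u = v" using v by simp
    moreover have "mat_adjoint S *\<^sub>v 0\<^sub>v m = 0\<^sub>v m"
      using S by (intro eq_vecI) (auto simp: scalar_prod_def)
    ultimately have "u \<noteq> 0\<^sub>v m" using \<open>v \<noteq> 0\<^sub>v m\<close> by auto
    with u obtain s where s: "s < m" "u $ s \<noteq> 0" by (auto simp: vec_eq_iff)
    have "(M *\<^sub>v v) \<bullet>c v = (\<Sum>i<m. (\<Sum>j<m. M $$ (i, j) * v $ j) * cnj (v $ i))"
      using M v by (simp add: scalar_prod_def atLeast0LessThan)
    also have "\<dots> = (\<Sum>i<m. \<Sum>j<m. \<Sum>s<m.
        of_real (d s) * ((cnj (T $$ (j, s)) * v $ j) * cnj (cnj (T $$ (i, s)) * v $ i)))"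
      by (simp add: Mij sum_distrib_right sum_distrib_left) (simp add: ac_simps)
    also have "\<dots> = (\<Sum>s<m. \<Sum>j<m. \<Sum>i<m.
        of_real (d s) * ((cnj (T $$ (j, s)) * v $ j) * cnj (cnj (T $$ (i, s)) * v $ i)))"
      by (subst sum.swap, subst (2) sum.swap, subst sum.swap) simp
    also have "\<dots> = (\<Sum>s<m. of_real (d s) * (u $ s * cnj (u $ s)))"
      by (intro sum.cong refl)
        (simp only: us lessThan_iff cnj_sum sum_product, simp only: sum_distrib_left)
    also have "\<dots> = of_real (\<Sum>s<m. d s * (cmod (u $ s))\<^sup>2)"
      by (simp add: complex_norm_square del: of_real_power)
    also have "0 < \<dots>"
    proof -
      have "0 < (\<Sum>s<m. d s * (cmod (u $ s))\<^sup>2)"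
        using s d by (intro sum_pos2[of _ s]) (auto simp: less_imp_le)
      then show ?thesis by (simp add: less_complex_def)
    qed
    finally show ?thesis .
  qed
  show ?thesis
    using M herm pos by (simp add: pos_def_mat_def flip: M_def)
qed

section \<open>Matrix inner products for a congruent diagonal weight\<close>

lemma mpoly_eval_mult:
  assumes "P \<in> carrier_mat m n" "Q \<in> carrier_mat n k"
  shows "mpoly_eval (P * Q) x = mpoly_eval P x * mpoly_eval Q x"
  using assms by (intro eq_matI) (auto simp: mpoly_eval_def scalar_prod_def poly_sum)

text \<open>Regrouping moves \<open>T\<close> from the weight into the polynomials: P and Q are
  replaced by P T and Q T, and the remaining diagonal weight splits into scalar ones.\<close>

lemma mpoly_inner_diag_congruence:
  assumes PQ: "P \<in> carrier_mat m m" "Q \<in> carrier_mat m m" and T: "T \<in> carrier_mat m m"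
    and w: "\<And>s. s < m \<Longrightarrow> scalar_weight J (w s)"
    and W: "\<And>x. x \<in> J \<Longrightarrow> W x = mpoly_eval T x * mat_diag m (\<lambda>s. of_real (w s x))
              * mat_adjoint (mpoly_eval T x)"
    and ij: "i < m" "j < m"
  shows "mpoly_inner m J W P Q $$ (i, j)
    = (\<Sum>s<m. scalar_inner J (w s) ((P * T) $$ (i, s)) ((Q * T) $$ (j, s)))"
proof -
  have "(mpoly_eval P x * W x * mat_adjoint (mpoly_eval Q x)) $$ (i, j) =
      (\<Sum>s<m. poly ((P * T) $$ (i, s)) (of_int x) * of_real (w s x)
        * cnj (poly ((Q * T) $$ (j, s)) (of_int x)))" if "x \<in> J" for x
  proof -
    define EP EQ ET D where "EP = mpoly_eval P x" "EQ = mpoly_eval Q x" "ET = mpoly_eval T x"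
      "D = mat_diag m (\<lambda>s. complex_of_real (w s x))"
    note defs = this
    have c: "EP \<in> carrier_mat m m" "EQ \<in> carrier_mat m m" "ET \<in> carrier_mat m m"
      "D \<in> carrier_mat m m" "mat_adjoint EQ \<in> carrier_mat m m" "mat_adjoint ET \<in> carrier_mat m m"
      using PQ T by (auto simp: defs mpoly_eval_def)
    have "EP * (ET * D * mat_adjoint ET) * mat_adjoint EQ = EP * ET * D * mat_adjoint (EQ * ET)"
      unfolding mat_adjoint_mult[OF c(2,3)] using c
        by (simp add: assoc_mult_mat[where ?n\<^sub>1=m and ?n\<^sub>2=m and ?n\<^sub>3=m and ?n\<^sub>4=m])
    moreover have "EP * ET = mpoly_eval (P * T) x" "EQ * ET = mpoly_eval (Q * T) x"
      using PQ T by (simp_all add: defs mpoly_eval_mult)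
    ultimately show ?thesis
      using PQ T ij W[OF that] mat_diag_congruence_index[of "EP * ET" m m "EQ * ET" m i j]
      by (simp add: defs mpoly_eval_def)
  qed
  then show ?thesis
    using ij infsum_finite_sum[of "{..<m}", OF summable_on_scalar_inner[OF w]]
    by (simp add: mpoly_inner_def scalar_inner_def cong: infsum_cong)
qed

section \<open>The matrix function T(x) = I + A x\<close>

lemma T_mat_carrier: "T_mat m a x \<in> carrier_mat m m"
  by (simp add: T_mat_eq)

text \<open>A A = 0 gives (I + x A)(I - x A) = I. This is the inverse used for the positive
  definiteness of \<open>W_mat\<close>.\<close>

lemma T_mat_mult_minus: "T_mat m a x * T_mat m a (- x) = 1\<^sub>m m"
proof -
  define B where "B = (of_int x :: complex) \<cdot>\<^sub>m A_mat m a"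
  have B: "B \<in> carrier_mat m m" by (simp add: B_def)
  have B2: "B * B = 0\<^sub>m m m"
    using mult_smult_assoc_mat[OF A_mat_carrier[of m a] B, of "of_int x"]
      mult_smult_distrib[OF A_mat_carrier[of m a] A_mat_carrier[of m a], of "of_int x"]
    by (simp add: B_def A_mat_square)
  have B': "- of_int x \<cdot>\<^sub>m A_mat m a = - B"
    by (rule eq_matI) (auto simp: B_def carrier_matD[OF A_mat_carrier])
  have "(1\<^sub>m m + B) * (1\<^sub>m m + - B) = (1\<^sub>m m + - B) + (B + B * (- B))"
    using B by (subst add_mult_distrib_mat[of _ m m _ _ m], simp_all)
      (subst mult_add_distrib_mat[of _ m m _ m], simp_all)
  also have "B * (- B) = 0\<^sub>m m m"
    using B B2 by (intro eq_matI) (auto simp: uminus_mult_right_mat)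
  also have "(1\<^sub>m m + - B) + (B + 0\<^sub>m m m) = 1\<^sub>m m"
    using B by (intro eq_matI) auto
  finally show ?thesis by (simp add: T_mat_eq B' flip: B_def)
qed

text \<open>T as a matrix polynomial, so that Q_n T can be formed before evaluating at a
  point.\<close>

definition T_poly :: "nat \<Rightarrow> (nat \<Rightarrow> real) \<Rightarrow> complex poly mat" where
  "T_poly m a = 1\<^sub>m m + [:0, 1:] \<cdot>\<^sub>m mat_const (A_mat m a)"

lemma mat_const_carrier: "M \<in> carrier_mat n k \<Longrightarrow> mat_const M \<in> carrier_mat n k"
  by (simp add: mat_const_def)

lemma T_poly_carrier: "T_poly m a \<in> carrier_mat m m"
  by (simp add: T_poly_def mat_const_carrier)

lemma mpoly_eval_T_poly: "mpoly_eval (T_poly m a) x = T_mat m a x"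
  by (rule eq_matI)
    (auto simp: mpoly_eval_def T_poly_def mat_const_def T_mat_eq carrier_matD[OF A_mat_carrier])

text \<open>The diagonal has polynomial entries: the constant 1 gives A A = 0, and the diagonal of
  P_{n+1} gives A P_{n+1} A = 0.\<close>

lemma mat_const_A_square_diag:
  "mat_const (A_mat m a) * mat_diag m d * mat_const (A_mat m a) = 0\<^sub>m m m"
proof -
  define C where "C = mat_const (A_mat m a)"
  have C: "C \<in> carrier_mat m m" by (simp add: C_def mat_const_carrier)
  have C0: "C $$ (r, s) = 0" if "r < m" "s < m" "odd r \<or> even s" for r s
    using A_mat_eq_0[OF that, of a] that by (simp add: C_def mat_const_def carrier_matD[OF A_mat_carrier])
  have "C $$ (r, k) * d k * C $$ (k, s) = 0" if "r < m" "s < m" "k < m" for r k s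
    using C0[of r k] C0[of k s] that by (cases "even k") auto
  then have "C * mat_diag m d * C = 0\<^sub>m m m"
    unfolding mat_diag_mult_right[OF C] using C
    by (intro eq_matI) (auto simp: scalar_prod_def intro!: sum.neutral)
  then show ?thesis by (simp add: C_def)
qed

section \<open>The scalar orthogonal polynomials, including the extra degree N + 1\<close>

locale diagonal_weights =
  fixes m :: nat and J :: "int set"
    and w :: "nat \<Rightarrow> int \<Rightarrow> real" and a :: "nat \<Rightarrow> real"
    and p :: "nat \<Rightarrow> nat \<Rightarrow> complex poly"
  assumes m: "m \<ge> 1"
    and J: "J = \<nat> \<or> (\<exists>N::nat. J = {0..int N})"
    and mop: "\<And>i. i \<in> {1..m} \<Longrightarrow> monic_orthogonal_polys J (w i) (p i)"
    and p_last: "\<And>i N. i \<in> {1..m} \<Longrightarrow> J = {0..int N} \<Longrightarrow>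
      p i (Suc N) = (\<Prod>k\<le>N. [:- of_nat k, 1:])"
begin

abbreviation \<alpha> :: "nat \<Rightarrow> nat \<Rightarrow> complex" where "\<alpha> r s \<equiv> A_mat m a $$ (r, s)"

text \<open>Matrix rows count from 0, weights and polynomials from 1; the shift is absorbed
  here.\<close>

abbreviation q :: "nat \<Rightarrow> nat \<Rightarrow> complex poly" where "q s n \<equiv> p (Suc s) n"

abbreviation h :: "nat \<Rightarrow> nat \<Rightarrow> complex" where
  "h s n \<equiv> scalar_inner J (w (Suc s)) (q s n) (q s n)"

text \<open>Entries of the constant matrix in S_n; the value 0 at \<open>n = 0\<close> implements
  P_{-1} = 0.\<close>

definition \<sigma> :: "nat \<Rightarrow> nat \<Rightarrow> nat \<Rightarrow> complex" where
  "\<sigma> n r s = (case n of 0 \<Rightarrow> 0 | Suc k \<Rightarrow> h r n * cnj (\<alpha> s r) * inverse (h s k))"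

lemma weight: "s < m \<Longrightarrow> scalar_weight J (w (Suc s))"
  using mop[of "Suc s"] by (auto simp: monic_orthogonal_polys_def)

lemma J_downward: "int n \<in> J \<Longrightarrow> k \<le> n \<Longrightarrow> int k \<in> J"
  using J by auto

lemma monic:
  assumes "s < m" "int n \<in> J"
  shows "degree (q s n) = n" "coeff (q s n) n = 1"
  using mop[of "Suc s"] assms by (auto simp: monic_orthogonal_polys_def)

lemma next_cases:
  assumes "int n \<in> J"
  shows "int (Suc n) \<in> J \<or> J = {0..int n}"
  using J assms by auto

text \<open>At the last degree N of a finite support, orthogonality says nothing about degree N + 1;
  there the explicit product x(x-1)...(x-N) is used.\<close>

lemma monic_Suc:
  assumes "s < m" "int n \<in> J"
  shows "degree (q s (Suc n)) = Suc n" "coeff (q s (Suc n)) (Suc n) = 1"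
proof -
  have *: "degree (\<Prod>k\<le>N. [:- of_nat k, 1:] :: complex poly) = Suc N"
    "lead_coeff (\<Prod>k\<le>N. [:- of_nat k, 1:] :: complex poly) = 1" for N :: nat
    by (subst degree_prod_eq_sum_degree) (auto simp: lead_coeff_prod)
  show "degree (q s (Suc n)) = Suc n"
    using next_cases[OF assms(2)] monic(1)[OF assms(1), of "Suc n"] *(1)[of n] p_last[of "Suc s" n] assms(1)
    by auto
  show "coeff (q s (Suc n)) (Suc n) = 1"
    using next_cases[OF assms(2)] monic(2)[OF assms(1), of "Suc n"] *[of n] p_last[of "Suc s" n] assms(1)
    by auto
qed

text \<open>Each support point is a root of one factor of the product, so the polynomial of degree N
  + 1 is null for the inner product.\<close>

lemma scalar_inner_last:
  assumes "s < m" "J = {0..int n}"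
  shows "scalar_inner J (w (Suc s)) (q s (Suc n)) f = 0"
proof (rule scalar_inner_eq_0_left)
  fix x assume "x \<in> J"
  then obtain k where "x = int k" "k \<le> n" using assms(2) by (metis atLeastAtMost_iff nonneg_int_cases of_nat_le_iff)
  then show "poly (q s (Suc n)) (of_int x) = 0"
    using p_last[of "Suc s" n] assms by (auto simp: poly_prod prod_zero_iff intro!: bexI[of _ k])
qed

text \<open>The hypotheses also admit the degree N + 1, which enters through A P_{n+1}; its
  polynomial vanishes on \<open>J\<close>, and conjugate symmetry covers it in the second argument.
  At degree 0 the truncated \<open>n - 1\<close> is again 0.\<close>

lemma orth:
  assumes "s < m" "n \<noteq> k" "int n \<in> J \<or> int (n - 1) \<in> J" "int k \<in> J \<or> int (k - 1) \<in> J"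
  shows "scalar_inner J (w (Suc s)) (q s n) (q s k) = 0"
proof (cases "int n \<in> J \<and> int k \<in> J")
  case True
  then show ?thesis using mop[of "Suc s"] assms by (auto simp: monic_orthogonal_polys_def)
next
  case False
  have last: "\<exists>l. i = Suc l \<and> J = {0..int l}" if "int i \<notin> J" "int (i - 1) \<in> J" for i
    using that next_cases[of "i - 1"] by (cases i) auto
  from False assms(3,4) have "int n \<notin> J \<and> int (n - 1) \<in> J \<or> int k \<notin> J \<and> int (k - 1) \<in> J"
    by auto
  then show ?thesis
    using last[of n] last[of k] scalar_inner_last[OF assms(1)]
      scalar_inner_cnj[of J "w (Suc s)" "q s n" "q s k"] by auto
qed

text \<open>A finite support has N + 1 points, more than any degree up to N.\<close>

lemma h_pos:
  assumes "s < m" "int n \<in> J"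
  shows "\<exists>r>0. h s n = of_real r"
proof (rule scalar_inner_self_pos[OF weight[OF assms(1)]])
  show "q s n \<noteq> 0" using monic[OF assms] by auto
  show "infinite J \<or> degree (q s n) < card J"
    using J
  proof
    assume "J = \<nat>"
    moreover have "infinite (\<nat> :: int set)" 
      by (simp add: Nats_def infinite_iff_countable_subset)
    ultimately show ?thesis by simp
  next
    assume "\<exists>N. J = {0..int N}"
    then show ?thesis using assms monic(1)[OF assms] by auto
  qed
qed

section \<open>W is a weight matrix\<close>

lemma W_mat_eq:
  "W_mat m a w x = T_mat m a x * mat_diag m (\<lambda>s. of_real (w (Suc s) x)) * mat_adjoint (T_mat m a x)"
  by (simp add: W_mat_def diag_of_def)

lemma weight_matrix_W: "weight_matrix m J (W_mat m a w)"
  unfolding weight_matrix_def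
proof (intro conjI ballI allI impI)
  fix x assume "x \<in> J"
  then show "pos_def_mat m (W_mat m a w x)"
    unfolding W_mat_eq using weight
    by (intro pos_def_mat_congruence[OF T_mat_carrier T_mat_carrier T_mat_mult_minus])
      (auto simp: scalar_weight_def)
next
  fix x assume "x \<notin> J"
  then have "mat_diag m (\<lambda>s. of_real (w (Suc s) x)) = (0\<^sub>m m m :: complex mat)"
    using weight by (intro eq_matI) (auto simp: mat_diag_def scalar_weight_def)
  then show "W_mat m a w x = 0\<^sub>m m m"
    unfolding W_mat_eq using T_mat_carrier[of m a x]
    by (simp add: left_mult_zero_mat[of "mat_adjoint (T_mat m a x)" m m])
next
  fix n i j assume ij: "i < m" "j < m"
  \<comment> \<open>An entry of x^n W(x) is a finite sum of scalar summands; the power x^n is put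
    into the left polynomial, so convergence follows from the scalar case.\<close>
  define f where "f s = monom 1 n * T_poly m a $$ (i, s)" for s
  define g where "g s = T_poly m a $$ (j, s)" for s
  have ev: "T_mat m a x $$ (i, s) = poly (T_poly m a $$ (i, s)) (of_int x)" if "i < m" "s < m" for i s x
    using that T_poly_carrier[of m a] by (simp add: mpoly_eval_def flip: mpoly_eval_T_poly)
  have "(of_int x ^ n \<cdot>\<^sub>m W_mat m a w x) $$ (i, j) =
      (\<Sum>s<m. poly (f s) (of_int x) * of_real (w (Suc s) x) * cnj (poly (g s) (of_int x)))" for x
  proof -
    have "(of_int x ^ n \<cdot>\<^sub>m W_mat m a w x) $$ (i, j) = of_int x ^ n * W_mat m a w x $$ (i, j)"
      using ij T_mat_carrier[of m a x] by (simp add: W_mat_eq)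
    then show ?thesis
      unfolding W_mat_eq mat_diag_congruence_index[OF T_mat_carrier T_mat_carrier ij]
      by (simp add: sum_distrib_left f_def g_def ev ij poly_monom ac_simps)
  qed
  then show "(\<lambda>x. (of_int x ^ n \<cdot>\<^sub>m W_mat m a w x) $$ (i, j)) summable_on J"
    using summable_on_finite_sum[of "{..<m}", OF summable_on_scalar_inner[OF weight]] by simp
qed


section \<open>Entries of P_n and S_n, and the product Q_n T\<close>

abbreviation C :: "complex poly mat" where "C \<equiv> mat_const (A_mat m a)"

lemma C_carrier: "C \<in> carrier_mat m m"
  by (simp add: mat_const_carrier)

lemma C_index: "r < m \<Longrightarrow> s < m \<Longrightarrow> C $$ (r, s) = [:\<alpha> r s:]"
  by (simp add: mat_const_def carrier_matD[OF A_mat_carrier])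

lemma P_poly_carrier: "P_poly m p n \<in> carrier_mat m m"
  by (simp add: P_poly_def diag_of_def)

lemma P_poly_index: "r < m \<Longrightarrow> s < m \<Longrightarrow> P_poly m p n $$ (r, s) = (if r = s then q r n else 0)"
  by (simp add: P_poly_def diag_of_def mat_diag_def)

lemma P_norm2_carrier:
  "P_norm2 m J w p n * mat_adjoint (A_mat m a) * P_norm2_inv m J w p k \<in> carrier_mat m m"
  by (auto simp: P_norm2_def P_norm2_inv_def diag_of_def mat_diag_def)

lemma S_poly_carrier: "S_poly m J a w p n \<in> carrier_mat m m"
  by (cases n) (auto simp: S_poly_def intro!: mult_carrier_mat[of _ m m] mat_const_carrier
      P_norm2_carrier P_poly_carrier)

text \<open>At \<open>n = 0\<close> the index \<open>n - 1\<close> truncates to 0, but then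
  \<open>\<sigma>\<close> is 0 and the formula still holds.\<close>

lemma S_poly_index:
  assumes "r < m" "s < m"
  shows "S_poly m J a w p n $$ (r, s) = Polynomial.smult (\<sigma> n r s) (q s (n - 1))"
proof (cases n)
  case 0
  then show ?thesis using assms by (simp add: S_poly_def \<sigma>_def)
next
  case (Suc k)
  let ?M = "P_norm2 m J w p n * mat_adjoint (A_mat m a) * P_norm2_inv m J w p k"
  have adj: "mat_adjoint (A_mat m a) \<in> carrier_mat m m"
    by (auto simp: carrier_matD[OF A_mat_carrier])
  have "?M $$ (r, s) = \<sigma> n r s"
    using assms unfolding P_norm2_def P_norm2_inv_def diag_of_def mat_diag_mult_left[OF adj]
    by (subst mat_diag_mult_right[of _ m])
      (auto simp: Suc \<sigma>_def carrier_matD[OF A_mat_carrier])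
  moreover have "(mat_const ?M * mat_diag m (\<lambda>s. q s k)) $$ (r, s) = mat_const ?M $$ (r, s) * q s k"
    using assms mat_diag_mult_right[OF mat_const_carrier[OF P_norm2_carrier[of n k]]] by simp
  ultimately show ?thesis
    using assms Suc carrier_matD[OF P_norm2_carrier[of n k]]
    by (simp add: S_poly_def P_poly_def diag_of_def mat_const_def)
qed

definition R_poly :: "nat \<Rightarrow> complex poly mat" where
  "R_poly n = P_poly m p n + C * P_poly m p (Suc n) - S_poly m J a w p n"

lemma Q_poly_carrier: "Q_poly m J a w p n \<in> carrier_mat m m"
  using C_carrier P_poly_carrier S_poly_carrier
  by (auto simp: Q_poly_def Let_def intro!: add_carrier_mat minus_carrier_mat mult_carrier_mat[of _ m m])

lemma Q_poly_mult_T: "Q_poly m J a w p n * T_poly m a = R_poly n"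
proof -
  \<comment> \<open>In these terms Q_n = U + V - U B and T = I + B. Since B B = 0 and V B = 0, the
    two terms U B cancel in the product and U + V remains.\<close>
  define U V B where "U = P_poly m p n - S_poly m J a w p n" "V = C * P_poly m p (Suc n)"
    "B = [:0, 1:] \<cdot>\<^sub>m C"
  note defs = this
  have c: "P_poly m p n \<in> carrier_mat m m" "S_poly m J a w p n \<in> carrier_mat m m"
      "U \<in> carrier_mat m m" "V \<in> carrier_mat m m" "B \<in> carrier_mat m m"
    using C_carrier P_poly_carrier S_poly_carrier[of n] by (auto simp: defs intro!: mult_carrier_mat[of _ m m])
  have "C * C = 0\<^sub>m m m"
    using mat_const_A_square_diag[of m a "\<lambda>_. 1"] C_carrier by simp
  then have "B * B = 0\<^sub>m m m"
    using mult_smult_assoc_mat[OF C_carrier c(5), of "[:0, 1:]"]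
      mult_smult_distrib[OF C_carrier C_carrier, of "[:0, 1:]"]
    by (simp add: defs)
  moreover have "V * B = 0\<^sub>m m m"
    using mult_smult_distrib[OF c(4) C_carrier, of "[:0, 1:]"] mat_const_A_square_diag[of m a]
    by (simp add: defs P_poly_def diag_of_def)
  moreover have "Q_poly m J a w p n = (U + V) - U * B"
  proof -
    have "Q_poly m J a w p n = P_poly m p n + V - S_poly m J a w p n
        - P_poly m p n * B + S_poly m J a w p n * B"
      by (simp add: Q_poly_def Let_def defs)
    moreover have "U * B = P_poly m p n * B - S_poly m J a w p n * B"
      unfolding defs(1) using c by (intro minus_mult_distrib_mat)
    ultimately show ?thesis
      using c by (intro eq_matI) (auto simp: defs(1) simp del: index_mult_mat(1))
  qed
  moreover have "((U + V) - U * B) * (1\<^sub>m m + B) = ((U + V) - U * B) + ((U * B + V * B) - U * (B * B))"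
  proof -
    have UB: "U * B \<in> carrier_mat m m" and Z: "(U + V) - U * B \<in> carrier_mat m m"
      using c by auto
    have "((U + V) - U * B) * B = (U + V) * B - U * B * B"
      using c UB by (intro minus_mult_distrib_mat) auto
    also have "(U + V) * B = U * B + V * B" using c by (intro add_mult_distrib_mat) auto
    also have "U * B * B = U * (B * B)" using c by (intro assoc_mult_mat) auto
    finally show ?thesis
      using mult_add_distrib_mat[OF Z one_carrier_mat c(5)] right_mult_one_mat[OF Z] by simp
  qed
  ultimately have "Q_poly m J a w p n * T_poly m a = ((U + V) - U * B) + ((U * B + 0\<^sub>m m m) - U * 0\<^sub>m m m)"
    by (simp add: T_poly_def defs)
  also have "\<dots> = R_poly n"
    using c unfolding R_poly_def by (intro eq_matI) (auto simp: defs simp flip: defs(2,3))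
  finally show ?thesis .
qed

section \<open>Orthogonality\<close>

text \<open>Each entry of Q_n T is a multiple of one scalar polynomial for the weight of its column;
  \<open>\<kappa>\<close> is the factor and \<open>deg\<close> the degree. The three cases come from
  P_n, A P_{n+1} and - S_n.\<close>

definition \<kappa> :: "nat \<Rightarrow> nat \<Rightarrow> nat \<Rightarrow> complex" where
  "\<kappa> n r s = (if r = s then 1 else if even r then \<alpha> r s else - \<sigma> n r s)"

definition deg :: "nat \<Rightarrow> nat \<Rightarrow> nat \<Rightarrow> nat" where
  "deg n r s = (if r = s then n else if even r then Suc n else n - 1)"

lemma \<alpha>_eq_0: "r < m \<Longrightarrow> s < m \<Longrightarrow> odd r \<or> even s \<Longrightarrow> \<alpha> r s = 0"
  by (rule A_mat_eq_0)

lemma \<sigma>_eq_0: "r < m \<Longrightarrow> s < m \<Longrightarrow> even r \<or> odd s \<Longrightarrow> \<sigma> n r s = 0"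
  using \<alpha>_eq_0[of s r] by (auto simp: \<sigma>_def split: nat.split)

lemma C_mult_P_index:
  "r < m \<Longrightarrow> s < m \<Longrightarrow> (C * P_poly m p n) $$ (r, s) = Polynomial.smult (\<alpha> r s) (q s n)"
  using C_carrier by (simp add: P_poly_def diag_of_def mat_diag_mult_right[of _ m] C_index)

text \<open>The three summands occupy disjoint positions: the diagonal, even rows with odd columns,
  and odd rows with even columns.\<close>

lemma R_poly_index:
  assumes "r < m" "s < m"
  shows "R_poly n $$ (r, s) = Polynomial.smult (\<kappa> n r s) (q s (deg n r s))"
  using assms C_carrier P_poly_carrier[of n] P_poly_carrier[of "Suc n"] S_poly_carrier[of n]
    \<alpha>_eq_0[OF assms] \<sigma>_eq_0[OF assms, of n]
  by (auto simp: R_poly_def P_poly_index C_mult_P_index S_poly_index \<kappa>_def deg_def simp del: index_mult_mat(1))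

lemma \<kappa>_eq_0:
  assumes "r < m" "s < m" "r \<noteq> s" "even r \<longleftrightarrow> even s"
  shows "\<kappa> n r s = 0"
  using assms \<alpha>_eq_0[of r s] \<sigma>_eq_0[of r s n] by (auto simp: \<kappa>_def)

text \<open>Only the columns \<open>r\<close> and \<open>r'\<close> contribute: for \<open>k = Suc n\<close> they give \<open>- \<alpha> r r' h r' k\<close> and \<open>\<alpha> r r' h r' k\<close>.\<close>

lemma R_orth_mixed:
  assumes r: "r < m" "even r" and r': "r' < m" "odd r'"
    and n: "int n \<in> J" and k: "int k \<in> J" and nk: "n \<noteq> k"
  shows "(\<Sum>s<m. scalar_inner J (w (Suc s)) (R_poly n $$ (r, s)) (R_poly k $$ (r', s))) = 0"
proof -
  let ?f = "\<lambda>s. \<kappa> n r s * cnj (\<kappa> k r' s) * scalar_inner J (w (Suc s)) (q s (deg n r s)) (q s (deg k r' s))"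
  have "r \<noteq> r'" using r r' by auto
  have "(\<Sum>s<m. scalar_inner J (w (Suc s)) (R_poly n $$ (r, s)) (R_poly k $$ (r', s))) = (\<Sum>s<m. ?f s)"
    using r r' by (simp add: R_poly_index scalar_inner_smult)
  also have "\<dots> = (\<Sum>s\<in>{r, r'}. ?f s)"
  proof (rule sum.mono_neutral_right)
    show "\<forall>s\<in>{..<m} - {r, r'}. ?f s = 0"
      using r r' \<kappa>_eq_0[of r _ n] \<kappa>_eq_0[of r' _ k] by auto
  qed (use r r' in auto)
  also have "\<dots> = ?f r + ?f r'" using \<open>r \<noteq> r'\<close> by simp
  also have "\<dots> = 0"
  proof (cases "k = Suc n")
    case True
    \<comment> \<open>Nonzero \<open>h r n\<close> cancels against its inverse in
      \<open>\<sigma>\<close>, and real norms are unaffected by the conjugation.\<close>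
    obtain x where x: "h r n = of_real x" "x > 0" using h_pos[OF r(1) n] by blast
    obtain y where y: "h r' k = of_real y" "y > 0" using h_pos[OF r'(1) k] by blast
    show ?thesis using \<open>r \<noteq> r'\<close> True x y r r' by (simp add: \<kappa>_def deg_def \<sigma>_def)
  next
    case False
    \<comment> \<open>Column \<open>r'\<close> pairs degrees n + 1 and k, column \<open>r\<close>
      pairs n and k - 1; away from k = n + 1 both terms vanish separately, for k = 0 because
      \<open>\<sigma>\<close> is 0.\<close>
    have "scalar_inner J (w (Suc r')) (q r' (Suc n)) (q r' k) = 0"
      using orth[OF r'(1), of "Suc n" k] n k False by auto
    moreover have "\<sigma> k r' r * scalar_inner J (w (Suc r)) (q r n) (q r (k - 1)) = 0"
    proof (cases k)
      case (Suc l)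
      then have "scalar_inner J (w (Suc r)) (q r n) (q r l) = 0"
        using orth[OF r(1), of n l] n k False J_downward[OF k, of l] by auto
      then show ?thesis using Suc by simp
    qed (simp add: \<sigma>_def)
    ultimately show ?thesis
      using \<open>r \<noteq> r'\<close> r r' by (auto simp: \<kappa>_def deg_def)
  qed
  finally show ?thesis .
qed

text \<open>Rows of opposite parity reduce to the mixed case, after conjugation if the odd row comes
  first. For equal parity every column contributes 0 by itself.\<close>

lemma R_orth:
  assumes r: "r < m" and r': "r' < m"
    and n: "int n \<in> J" and k: "int k \<in> J" and nk: "n \<noteq> k"
  shows "(\<Sum>s<m. scalar_inner J (w (Suc s)) (R_poly n $$ (r, s)) (R_poly k $$ (r', s))) = 0"
proof -
  consider "even r" "odd r'" | "odd r" "even r'" | "even r \<longleftrightarrow> even r'" by blast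
  then show ?thesis
  proof cases
    case 1
    then show ?thesis using R_orth_mixed assms by blast
  next
    case 2
    have "(\<Sum>s<m. scalar_inner J (w (Suc s)) (R_poly n $$ (r, s)) (R_poly k $$ (r', s)))
        = cnj (\<Sum>s<m. scalar_inner J (w (Suc s)) (R_poly k $$ (r', s)) (R_poly n $$ (r, s)))"
      by (simp flip: scalar_inner_cnj)
    then show ?thesis using R_orth_mixed[OF r' 2(2) r 2(1) k n] nk by simp
  next
    case 3
    have "scalar_inner J (w (Suc s)) (R_poly n $$ (r, s)) (R_poly k $$ (r', s)) = 0" if s: "s < m" for s
    proof (cases "\<kappa> n r s * cnj (\<kappa> k r' s) = 0")
      case False
      then have *: "\<kappa> n r s \<noteq> 0" "\<kappa> k r' s \<noteq> 0" by auto
      \<comment> \<open>If both factors are nonzero, n and k are shifted alike. In odd rows this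
        also rules out the truncation 0 - 1 = 1 - 1, since \<open>\<sigma>\<close> vanishes at
        0.\<close>
      have "deg n r s \<noteq> deg k r' s"
        using * 3 nk \<kappa>_eq_0[OF r s, of n] \<kappa>_eq_0[OF r' s, of k]
        by (auto simp: deg_def \<kappa>_def \<sigma>_def split: nat.splits if_splits)
      moreover have "int (deg n r s) \<in> J \<or> int (deg n r s - 1) \<in> J" if "int n \<in> J" for n r
        using J_downward[OF that] that by (auto simp: deg_def)
      ultimately have "scalar_inner J (w (Suc s)) (q s (deg n r s)) (q s (deg k r' s)) = 0"
        using orth[OF s] n k by blast
      then show ?thesis using r r' s by (simp add: R_poly_index scalar_inner_smult)
    qed (use r r' s in \<open>auto simp: R_poly_index scalar_inner_smult\<close>)
    then show ?thesis by simp
  qed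
qed

lemma Q_orth:
  assumes "int n \<in> J" "int k \<in> J" "n \<noteq> k"
  shows "mpoly_inner m J (W_mat m a w) (Q_poly m J a w p n) (Q_poly m J a w p k) = 0\<^sub>m m m"
proof (rule eq_matI)
  fix i j assume "i < dim_row (0\<^sub>m m m :: complex mat)" "j < dim_col (0\<^sub>m m m :: complex mat)"
  then have ij: "i < m" "j < m" by auto
  have "mpoly_inner m J (W_mat m a w) (Q_poly m J a w p n) (Q_poly m J a w p k) $$ (i, j) =
    (\<Sum>s<m. scalar_inner J (w (Suc s)) ((Q_poly m J a w p n * T_poly m a) $$ (i, s))
       ((Q_poly m J a w p k * T_poly m a) $$ (j, s)))"
    using mpoly_inner_diag_congruence[OF Q_poly_carrier Q_poly_carrier T_poly_carrier[of m a] weight _ ij]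
    by (simp add: mpoly_eval_T_poly W_mat_eq)
  also have "\<dots> = 0"
    unfolding Q_poly_mult_T using R_orth[OF ij assms] .
  finally show "mpoly_inner m J (W_mat m a w) (Q_poly m J a w p n) (Q_poly m J a w p k) $$ (i, j)
      = 0\<^sub>m m m $$ (i, j)"
    using ij by simp
qed (auto simp: mpoly_inner_def)


section \<open>Degree and leading coefficient of Q_n\<close>

lemma Q_poly_index:
  assumes rs: "r < m" "s < m"
  shows "Q_poly m J a w p n $$ (r, s) = (if r = s then q r n else 0)
    + Polynomial.smult (\<alpha> r s) (q s (Suc n)) - Polynomial.smult (\<sigma> n r s) (q s (n - 1))
    - pCons 0 (Polynomial.smult (\<alpha> r s) (q r n))
    + (\<Sum>t<m. pCons 0 (Polynomial.smult (\<sigma> n r t * \<alpha> t s) (q t (n - 1))))"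
proof -
  have XC: "[:0, 1:] \<cdot>\<^sub>m C \<in> carrier_mat m m" using C_carrier by simp
  have "(P_poly m p n * ([:0, 1:] \<cdot>\<^sub>m C)) $$ (r, s) = pCons 0 (Polynomial.smult (\<alpha> r s) (q r n))"
    using rs C_carrier by (simp add: P_poly_def diag_of_def mat_diag_mult_left[OF XC] C_index)
  moreover have "(S_poly m J a w p n * ([:0, 1:] \<cdot>\<^sub>m C)) $$ (r, s)
      = (\<Sum>t<m. S_poly m J a w p n $$ (r, t) * ([:0, 1:] * C $$ (t, s)))"
    using rs C_carrier S_poly_carrier[of n] by (simp add: scalar_prod_def atLeast0LessThan)
  moreover have "\<dots> = (\<Sum>t<m. pCons 0 (Polynomial.smult (\<sigma> n r t * \<alpha> t s) (q t (n - 1))))"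
    using rs by (intro sum.cong refl) (simp add: S_poly_index C_index ac_simps)
  ultimately show ?thesis
    using rs C_carrier P_poly_carrier S_poly_carrier[of n]
    by (simp add: Q_poly_def Let_def P_poly_index C_mult_P_index S_poly_index
        carrier_matD[OF C_carrier] carrier_matD[OF P_poly_carrier] carrier_matD[OF S_poly_carrier]
        del: index_mult_mat(1))
qed

text \<open>The coefficient of x^n in Q_n. The middle term is what A P_{n+1} - P_n A x leaves below
  its cancelled top degree (\<open>pCons 0\<close> multiplies by x); the last sum comes from S_n A
  x.\<close>

definition lead :: "nat \<Rightarrow> nat \<Rightarrow> nat \<Rightarrow> complex" where
  "lead n r s = (if r = s then 1 else 0)
     + \<alpha> r s * (coeff (q s (Suc n)) n - coeff (pCons 0 (q r n)) n) + (\<Sum>t<m. \<sigma> n r t * \<alpha> t s)"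

text \<open>One statement serves both the degree bound (k > n) and the leading coefficient (k =
  n).\<close>

lemma coeff_Q_poly:
  assumes rs: "r < m" "s < m" and n: "int n \<in> J" and k: "k \<ge> n"
  shows "coeff (Q_poly m J a w p n $$ (r, s)) k = (if k = n then lead n r s else 0)"
proof -
  have top: "coeff (q t n) k = (if k = n then 1 else 0)" if "t < m" for t
    using monic[OF that n] k by (auto intro: coeff_eq_0)
  \<comment> \<open>For n > 0 the degree n - 1 is below k; for n = 0 the factor
    \<open>\<sigma>\<close> is 0.\<close>
  have S: "\<sigma> n r t * coeff (q t (n - 1)) k = 0" if "t < m" for t
  proof (cases n)
    case (Suc l)
    then show ?thesis using monic(1)[OF that J_downward[OF n, of l]] k by (auto intro: coeff_eq_0)
  qed (simp add: \<sigma>_def)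
  have SA: "\<sigma> n r t * coeff (pCons 0 (q t (n - 1))) k = (if k = n then \<sigma> n r t else 0)" if "t < m" for t
  proof (cases n)
    case (Suc l)
    then show ?thesis using monic[OF that J_downward[OF n, of l]] k
      by (auto simp: coeff_pCons coeff_eq_0 split: nat.splits)
  qed (simp add: \<sigma>_def)
  have A: "coeff (q s (Suc n)) k - coeff (pCons 0 (q r n)) k
      = (if k = n then coeff (q s (Suc n)) n - coeff (pCons 0 (q r n)) n else 0)"
  proof (cases "k = n")
    case False
    with k obtain l where "k = Suc l" "l \<ge> n" by (cases k) auto
    then show ?thesis
      using monic_Suc[OF rs(2) n] monic[OF rs(1) n] by (cases "l = n") (auto simp: coeff_eq_0)
  qed simp
  have "coeff (Q_poly m J a w p n $$ (r, s)) k
    = (if r = s then coeff (q r n) k else 0)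
      + \<alpha> r s * (coeff (q s (Suc n)) k - coeff (pCons 0 (q r n)) k) - \<sigma> n r s * coeff (q s (n - 1)) k
      + (\<Sum>t<m. \<sigma> n r t * coeff (pCons 0 (q t (n - 1))) k * \<alpha> t s)"
    using rs by (simp add: Q_poly_index coeff_sum coeff_pCons algebra_simps split: nat.split)
  also have "(\<Sum>t<m. \<sigma> n r t * coeff (pCons 0 (q t (n - 1))) k * \<alpha> t s)
      = (\<Sum>t<m. (if k = n then \<sigma> n r t else 0) * \<alpha> t s)"
    by (intro sum.cong refl) (simp only: SA lessThan_iff)
  finally show ?thesis
    unfolding S[OF rs(2)] A top[OF rs(1)] by (simp add: lead_def)
qed

text \<open>
  In block form (even rows first) the leading coefficient is \<open>[I, B; 0, I + H A\<^sup>* G A]\<close> with \<open>H\<close>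
  positive and \<open>G\<close> nonnegative diagonal. The odd rows of a kernel vector satisfy \<open>v = - H y\<close> with \<open>y = A\<^sup>* G A v\<close>; pairing \<open>v\<close> with
  \<open>y\<close> gives \<open>0 \<le> (A v)\<^sup>* G (A v) = - y\<^sup>* H y\<close>, so \<open>H y = 0\<close>.
\<close>

lemma lead_kernel:
  assumes n: "int n \<in> J" and Lv: "\<And>r. r < m \<Longrightarrow> (\<Sum>s<m. lead n r s * v s) = 0" and r: "r < m"
  shows "v r = 0"
proof -
  define u where "u t = (\<Sum>s<m. \<alpha> t s * v s)" for t
  define H where "H r = Re (h r n)" for r
  \<comment> \<open>The diagonal of the inverse of ||P_{n-1}||^2; the value 0 at n = 0 keeps the
    factorisation of \<open>\<sigma>\<close> below valid there.\<close>
  define G where "G t = (case n of 0 \<Rightarrow> 0 | Suc k \<Rightarrow> inverse (Re (h t k)))" for t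
  have H: "H r > 0" "h r n = of_real (H r)" if "r < m" for r
    using h_pos[OF that n] by (auto simp: H_def)
  have G: "G t \<ge> 0" "\<sigma> n r t = of_real (H r) * cnj (\<alpha> t r) * of_real (G t)" if "t < m" "r < m" for r t
  proof -
    have "G t \<ge> 0 \<and> \<sigma> n r t = of_real (H r) * cnj (\<alpha> t r) * of_real (G t)"
    proof (cases n)
      case (Suc k)
      then show ?thesis
        using h_pos[OF that(1) J_downward[OF n, of k]] H(2)[OF that(2)]
        by (auto simp: G_def \<sigma>_def of_real_inverse)
    qed (simp add: G_def \<sigma>_def)
    then show "G t \<ge> 0" "\<sigma> n r t = of_real (H r) * cnj (\<alpha> t r) * of_real (G t)" by auto
  qed
  define y where "y r = (\<Sum>t<m. cnj (\<alpha> t r) * of_real (G t) * u t)" for r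
  \<comment> \<open>Row \<open>r\<close> of the kernel equation, split into the three parts of
    \<open>lead\<close>.\<close>
  have row: "v r + (\<Sum>s<m. \<alpha> r s * (coeff (q s (Suc n)) n - coeff (pCons 0 (q r n)) n) * v s)
      + of_real (H r) * y r = 0" if r: "r < m" for r
  proof -
    have "(\<Sum>s<m. (\<Sum>t<m. \<sigma> n r t * \<alpha> t s) * v s) = (\<Sum>t<m. \<sigma> n r t * u t)"
      by (simp add: u_def sum_distrib_left sum_distrib_right mult.assoc) (rule sum.swap)
    also have "\<dots> = of_real (H r) * y r"
      unfolding y_def sum_distrib_left by (intro sum.cong refl) (simp add: G(2) r ac_simps)
    finally have "(\<Sum>s<m. (\<Sum>t<m. \<sigma> n r t * \<alpha> t s) * v s) = of_real (H r) * y r" .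
    moreover have "(\<Sum>s<m. (if r = s then 1 else 0) * v s) = v r"
      using r by (simp add: if_distrib if_distribR sum.delta cong: if_cong)
    ultimately show ?thesis
      using Lv[OF r] by (simp only: lead_def distrib_right sum.distrib)
  qed
  have v_odd: "v r = - of_real (H r) * y r" if "r < m" "odd r" for r
  proof -
    have "(\<Sum>s<m. \<alpha> r s * (coeff (q s (Suc n)) n - coeff (pCons 0 (q r n)) n) * v s) = 0"
      using \<alpha>_eq_0[OF that(1)] that by (intro sum.neutral) auto
    then show ?thesis using row[OF that(1)] by (simp add: add_eq_0_iff)
  qed
  have y_even: "y r = 0" if "r < m" "even r" for r
    unfolding y_def using \<alpha>_eq_0[OF _ that(1)] that by (intro sum.neutral) auto
  have "of_real (\<Sum>t<m. G t * (cmod (u t))\<^sup>2) = (\<Sum>t<m. of_real (G t) * (u t * cnj (u t)))"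
    by (simp add: complex_norm_square del: of_real_power)
  also have "\<dots> = (\<Sum>t<m. \<Sum>s<m. cnj (v s) * (cnj (\<alpha> t s) * of_real (G t) * u t))"
    by (intro sum.cong refl) (simp add: u_def sum_distrib_left ac_simps)
  also have "\<dots> = (\<Sum>s<m. cnj (v s) * y s)"
    by (subst sum.swap) (simp add: y_def sum_distrib_left)
  also have "\<dots> = (\<Sum>s<m. - of_real (H s * (cmod (y s))\<^sup>2))"
  proof (intro sum.cong refl)
    fix s assume "s \<in> {..<m}"
    then show "cnj (v s) * y s = - of_real (H s * (cmod (y s))\<^sup>2)"
      using v_odd[of s] y_even[of s]
      by (cases "even s") (auto simp: complex_norm_square ac_simps simp del: of_real_power)
  qed
  also have "\<dots> = of_real (- (\<Sum>s<m. H s * (cmod (y s))\<^sup>2))"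
    by (simp add: sum_negf)
  finally have "(\<Sum>t<m. G t * (cmod (u t))\<^sup>2) = - (\<Sum>s<m. H s * (cmod (y s))\<^sup>2)"
    using of_real_eq_iff by blast
  moreover have "(\<Sum>t<m. G t * (cmod (u t))\<^sup>2) \<ge> 0"
    using G(1) by (intro sum_nonneg) auto
  moreover have Hy: "H s * (cmod (y s))\<^sup>2 \<ge> 0" if "s \<in> {..<m}" for s
    using H(1)[of s] that by auto
  ultimately have "(\<Sum>s<m. H s * (cmod (y s))\<^sup>2) = 0"
    using sum_nonneg[of "{..<m}" "\<lambda>s. H s * (cmod (y s))\<^sup>2"] by fastforce
  then have Hy0: "\<forall>s\<in>{..<m}. H s * (cmod (y s))\<^sup>2 = 0"
    using sum_nonneg_eq_0_iff[of "{..<m}" "\<lambda>s. H s * (cmod (y s))\<^sup>2"] Hy by blast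
  have y0: "y s = 0" if "s < m" for s using H(1)[OF that] bspec[OF Hy0, of s] that by simp
  then have v0: "v s = 0" if "s < m" "odd s" for s using v_odd that by simp
  \<comment> \<open>\<open>\<alpha> r s\<close> can be nonzero only for odd \<open>s\<close>, where
    \<open>v\<close> is already 0; so the even rows reduce to v = 0 as well.\<close>
  have "(\<Sum>s<m. \<alpha> r s * (coeff (q s (Suc n)) n - coeff (pCons 0 (q r n)) n) * v s) = 0"
    using \<alpha>_eq_0[OF r] v0 by (intro sum.neutral) (metis lessThan_iff mult_zero_left mult_zero_right)
  then show ?thesis using row[OF r] y0[OF r] by simp
qed

lemma Q_poly_elements:
  "elements_mat (Q_poly m J a w p n) = (\<lambda>(r, s). Q_poly m J a w p n $$ (r, s)) ` ({..<m} \<times> {..<m})"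
  using Q_poly_carrier[of n] by (force dest: elements_matD)

lemma degree_Q_poly:
  assumes n: "int n \<in> J"
  shows "mpoly_degree (Q_poly m J a w p n) = n"
  unfolding mpoly_degree_def
proof (rule Max_eqI)
  show "finite (degree ` elements_mat (Q_poly m J a w p n))" by (simp add: Q_poly_elements)
  have le: "degree (Q_poly m J a w p n $$ (r, s)) \<le> n" if "r < m" "s < m" for r s
    using coeff_Q_poly[OF that n] by (intro degree_le) auto
  then show "d \<le> n" if "d \<in> degree ` elements_mat (Q_poly m J a w p n)" for d
    using that by (auto simp: Q_poly_elements)
  \<comment> \<open>The corner entry attains the degree: row 0 is even, so \<open>\<sigma>\<close>
    vanishes along it, and so does the diagonal entry of A.\<close>
  have "lead n 0 0 = 1"
    using m \<alpha>_eq_0[of 0 0] \<sigma>_eq_0[of 0 _ n] by (auto simp: lead_def intro!: sum.neutral)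
  then have "degree (Q_poly m J a w p n $$ (0, 0)) = n"
    using m coeff_Q_poly[of 0 0 n n] n le[of 0 0] le_degree[of "Q_poly m J a w p n $$ (0, 0)" n]
    by (intro antisym) auto
  moreover have "Q_poly m J a w p n $$ (0, 0) \<in> elements_mat (Q_poly m J a w p n)"
    unfolding Q_poly_elements using m by (intro image_eqI[of _ _ "(0, 0)"]) auto
  ultimately show "n \<in> degree ` elements_mat (Q_poly m J a w p n)"
    by (metis imageI)
qed

lemma invertible_lead_coeff_Q_poly:
  assumes n: "int n \<in> J"
  shows "invertible_mat (mpoly_lead_coeff (Q_poly m J a w p n))"
proof -
  have M: "mpoly_lead_coeff (Q_poly m J a w p n) = mat m m (\<lambda>(r, s). lead n r s)"
    using Q_poly_carrier[of n]
    by (intro eq_matI) (auto simp: mpoly_lead_coeff_def degree_Q_poly[OF n] coeff_Q_poly[OF _ _ n])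
  show ?thesis
    unfolding M
  proof (rule invertible_mat_if_inj)
    fix v :: "complex vec" assume v: "v \<in> carrier_vec m"
      and Mv: "mat m m (\<lambda>(r, s). lead n r s) *\<^sub>v v = 0\<^sub>v m"
    have "(\<Sum>s<m. lead n r s * v $ s) = 0" if "r < m" for r
      using arg_cong[OF Mv, of "\<lambda>z. z $ r"] that v by (simp add: scalar_prod_def atLeast0LessThan)
    from lead_kernel[OF n this] show "v = 0\<^sub>v m"
      using v by (intro eq_vecI) auto
  qed simp
qed

lemma orthogonal_Q_poly: "orthogonal_mpolys m J (W_mat m a w) (Q_poly m J a w p)"
  unfolding orthogonal_mpolys_def
  by (intro conjI allI impI weight_matrix_W Q_poly_carrier degree_Q_poly
      invertible_lead_coeff_Q_poly Q_orth)

end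

theorem theorem3p1:
  fixes m :: nat and J :: "int set"
    and w :: "nat \<Rightarrow> int \<Rightarrow> real" and a :: "nat \<Rightarrow> real"
    and p :: "nat \<Rightarrow> nat \<Rightarrow> complex poly"
  assumes "m \<ge> 1"
    and "J = \<nat> \<or> (\<exists>N::nat. J = {0..int N})"
    and "\<And>i. i \<in> {1..m} \<Longrightarrow> scalar_weight J (w i)"
    and "\<And>i. i \<in> {1..m - 1} \<Longrightarrow> a i \<noteq> 0"
    and "\<And>i. i \<in> {1..m} \<Longrightarrow> monic_orthogonal_polys J (w i) (p i)"
    and "\<And>i N. i \<in> {1..m} \<Longrightarrow> J = {0..int N} \<Longrightarrow> p i (Suc N) = (\<Prod>k\<le>N. [:- of_nat k, 1:])"
  shows "orthogonal_mpolys m J (W_mat m a w) (Q_poly m J a w p)"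
proof -
  interpret diagonal_weights m J w a p
    using assms by unfold_locales auto
  show ?thesis by (rule orthogonal_Q_poly)
qed

end
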